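(* Let $(\mathcal D_n)_{n\ge1}$ be a sequence of feasible degree sequences such that there exist $\delta\ge 0$ and $d=d(n)$ satisfying $|S_n(d)|=\delta n+o(n)$. Let $p=p(n)\in[0,1]$. (a) If $p\ll 1/d$, then $\mathbb P[L_1(\mathbf G(\mathcal D_n)_p)\le \delta n+o(n)]=1-o(1)$. (b) If $p\gg 1/d$, then $\mathbb P[L_1(\mathbf G(\mathcal D_n)_p)\ge \delta n-o(n)]=1-o(1)$. Moreover, a $(1-o(1))$-proportion of the vertices in $S_n(d)$ belong to the same connected component of $\mathbf G(\mathcal D_n)_p$ a.a.s.
   Context: For each $n$, $\mathcal D_n=(d_1,\dots,d_n)$ is a sequence of integers $d_i\ge 1$ (depending on $n$) that is feasible, i.e. there is a simple graph on $[n]=\{1,\dots,n\}$ in which vertex $i$ has degree $d_i$ for all $i$. $\mathbf G(\mathcal D_n)$ is a uniformly random simple graph on $[n]$ among those in which each vertex $i$ has degree $d_i$. For a graph $G$ and $p\in[0,1]$, $G_p$ is the random subgraph on the same vertex set in which each edge of $G$ is kept independently with probability $p$; for $\mathbf G(\mathcal D_n)_p$ one first samples $\mathbf G(\mathcal D_n)$ and then percolates it. $L_1(G)$ is the number of vertices of a largest connected component of $G$. $S_n(x)=\{i\in[n]: d_i\ge x\}$ is the set of vertices of degree at least $x$ in $\mathbf G(\mathcal D_n)$ (before percolation). Asymptotics are as $n\to\infty$: $f\ll g$ (equivalently $f=o(g)$, $g\gg f$) means that for every $\varepsilon>0$, $f(n)\le\varepsilon g(n)$ for all large $n$; a.a.s.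 (asymptotically almost surely) means with probability tending to $1$. A statement such as $\mathbb P[X\le \delta n+o(n)]=1-o(1)$ means that for some function $h(n)=o(n)$, $\mathbb P[X\le\delta n+h(n)]\to1$.
   Formalization: The "Moreover" claim in (b) is stated only for δ>0; for δ=0 it is false: two vertices of degree about n^{1/3}, all others of degree 1, d=⌊n^{1/3}⌋, p=1 leaves the two vertices of S_n(d) in different components a.a.s. *)

theory Defs
  imports "HOL-Probability.Probability" "HOL-Library.Landau_Symbols"
begin

text \<open>
  A simple graph on \<open>[n] = {1..n}\<close> is represented by its edge set, a set of two-element
  subsets of \<open>{1..n}\<close>; the vertex set is carried separately, so that isolated vertices count.
\<close>

definition simple_graphs :: "nat \<Rightarrow> nat set set set" where
  "simple_graphs n = Pow {e. e \<subseteq> {1..n} \<and> card e = 2}"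

definition deg :: "nat set set \<Rightarrow> nat \<Rightarrow> nat" where
  "deg E v = card {e \<in> E. v \<in> e}"

definition graphs_with_degrees :: "nat \<Rightarrow> (nat \<Rightarrow> nat) \<Rightarrow> nat set set set" where
  "graphs_with_degrees n ds = {E \<in> simple_graphs n. \<forall>i\<in>{1..n}. deg E i = ds i}"

definition feasible :: "nat \<Rightarrow> (nat \<Rightarrow> nat) \<Rightarrow> bool" where
  "feasible n ds \<longleftrightarrow> (\<forall>i\<in>{1..n}. 1 \<le> ds i) \<and> graphs_with_degrees n ds \<noteq> {}"

definition random_graph :: "nat \<Rightarrow> (nat \<Rightarrow> nat) \<Rightarrow> nat set set pmf" where
  "random_graph n ds = pmf_of_set (graphs_with_degrees n ds)"

definition percolate :: "real \<Rightarrow> nat set set \<Rightarrow> nat set set pmf" where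
  "percolate p E = map_pmf (\<lambda>keep. {e \<in> E. keep e}) (Pi_pmf E False (\<lambda>_. bernoulli_pmf p))"

definition percolated_random_graph :: "nat \<Rightarrow> (nat \<Rightarrow> nat) \<Rightarrow> real \<Rightarrow> nat set set pmf" where
  "percolated_random_graph n ds p = bind_pmf (random_graph n ds) (percolate p)"

definition connected_rel :: "nat \<Rightarrow> nat set set \<Rightarrow> (nat \<times> nat) set" where
  "connected_rel n E = {(u, v). u \<in> {1..n} \<and> v \<in> {1..n} \<and> (u, v) \<in> {(x, y). {x, y} \<in> E}\<^sup>*}"

definition graph_components :: "nat \<Rightarrow> nat set set \<Rightarrow> nat set set" where
  "graph_components n E = {1..n} // connected_rel n E"

definition L1 :: "nat \<Rightarrow> nat set set \<Rightarrow> nat" where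
  "L1 n E = Max (card ` graph_components n E)"

definition S :: "nat \<Rightarrow> (nat \<Rightarrow> nat) \<Rightarrow> real \<Rightarrow> nat set" where
  "S n ds x = {i \<in> {1..n}. x \<le> real (ds i)}"

end

theory Submission
  imports Defs "HOL-Real_Asymp.Real_Asymp"
begin

text \<open>
  Write \<open>S\<close> for the set of vertices of degree at least \<open>d\<close>.

  If \<open>p d \<longrightarrow> 0\<close>, a vertex outside \<open>S\<close> keeps one of its fewer than \<open>d\<close> edges with probability
  at most \<open>p d\<close>, so by Markov's inequality only \<open>o(n)\<close> vertices outside \<open>S\<close> are not isolated after
  percolation. A component with more than one vertex lives on \<open>S\<close> and on these vertices
  (\<open>L1_le\<close>, \<open>prob_L1_large_le\<close>). This holds for every graph with the given degrees.

  If \<open>p d \<longrightarrow> \<infinity>\<close>, the randomness of the graph is essential: a disjoint union of small cliques has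
  no large component. Call a partition \<open>A\<close>, \<open>B\<close> of the vertices balanced if both parts contain at
  least \<open>a\<close> vertices of \<open>S\<close>. If no balanced partition separates the percolated graph, then some
  component contains all but \<open>2a\<close> vertices of \<open>S\<close> (\<open>component_of_uncut_set\<close>). By a union bound
  over the at most \<open>2\<^sup>n\<close> partitions it suffices that a given balanced partition separates the
  percolated graph with probability much less than \<open>2\<^sup>-\<^sup>n\<close>. Given the graph, this probability is
  \<open>(1 - p)\<^sup>k\<close>, where \<open>k\<close> is the number of edges between \<open>A\<close> and \<open>B\<close>; so \<open>k\<close> has to be of order
  \<open>a d\<close>, except with probability \<open>exp (- c a d)\<close>.

  This last estimate is a switching argument. In a graph with few crossing edges, most vertices
  \<open>x\<close> of \<open>A \<inter> S\<close> and \<open>z\<close> of \<open>B \<inter> S\<close> have most of their neighbours on their own side, which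
  gives order \<open>a\<^sup>2 d\<^sup>2\<close> ways to replace edges \<open>xy\<close> inside \<open>A\<close> and \<open>zw\<close> inside \<open>B\<close> by the crossing
  edges \<open>xw\<close> and \<open>yz\<close> (\<open>many_switchings\<close>). Conversely a graph with at most \<open>t + 2\<close> crossing edges is
  the result of at most \<open>(t + 2)\<^sup>2\<close> switchings. As long as \<open>t + 2 \<le> a d / 8\<close>, raising the permitted
  number of crossing edges from \<open>t\<close> to \<open>t + 2\<close> thus multiplies the number of graphs by at least \<open>4\<close>
  (\<open>sparse_cut_graphs_step\<close>), and iterating this gives the exponential bound. Since \<open>d \<ge> p d\<close>, the
  probability of separation is at most \<open>4 exp (- p a d / 32)\<close> (\<open>prob_cut_dies_le\<close>). With
  \<open>a = \<epsilon> n\<close> and \<open>\<epsilon> = 1 / sqrt (p d)\<close>, which tends to \<open>0\<close>, the exponent is \<open>n sqrt (p d) / 32\<close>; it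
  beats the factor \<open>2\<^sup>n\<close>, and all but \<open>o(n)\<close> vertices of \<open>S\<close> are in one component.
\<close>

section \<open>Neighbourhoods and crossing edges\<close>

definition nbrs :: "nat set set \<Rightarrow> nat \<Rightarrow> nat set" where
  "nbrs E v = {u. {v, u} \<in> E}"

definition crossing :: "nat set set \<Rightarrow> nat set \<Rightarrow> nat set \<Rightarrow> nat set set" where
  "crossing E A B = {e \<in> E. \<exists>a\<in>A. \<exists>b\<in>B. e = {a, b}}"

lemma finite_simple_graphs: "finite (simple_graphs n)"
proof -
  have "finite {e. e \<subseteq> {1..n} \<and> card e = 2}"
    by (rule finite_subset[of _ "Pow {1..n}"]) auto
  then show ?thesis by (simp add: simple_graphs_def)
qed

lemma simple_graph_finite: "E \<in> simple_graphs n \<Longrightarrow> finite E"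
  unfolding simple_graphs_def by (rule finite_subset[of _ "Pow {1..n}"]) auto

lemma simple_graph_edge:
  assumes "E \<in> simple_graphs n" "{u, v} \<in> E"
  shows "u \<noteq> v" "u \<in> {1..n}" "v \<in> {1..n}"
proof -
  have *: "{u, v} \<subseteq> {1..n}" "card {u, v} = 2"
    using assms by (auto simp: simple_graphs_def)
  then show "u \<in> {1..n}" "v \<in> {1..n}" by auto
  show "u \<noteq> v" using *(2) by auto
qed

lemma simple_graph_subset: "E \<in> simple_graphs n \<Longrightarrow> F \<subseteq> E \<Longrightarrow> F \<in> simple_graphs n"
  by (auto simp: simple_graphs_def)

lemma nbrs_subset:
  assumes "E \<in> simple_graphs n"
  shows "nbrs E v \<subseteq> {1..n}"
proof
  fix u assume "u \<in> nbrs E v"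
  then show "u \<in> {1..n}" using simple_graph_edge(3)[OF assms, of v u] by (simp add: nbrs_def)
qed

lemma finite_nbrs: "E \<in> simple_graphs n \<Longrightarrow> finite (nbrs E v)"
  by (rule finite_subset[OF nbrs_subset]) auto

lemma card_nbrs:
  assumes E: "E \<in> simple_graphs n"
  shows "card (nbrs E v) = deg E v"
proof -
  have "bij_betw (\<lambda>u. {v, u}) (nbrs E v) {e \<in> E. v \<in> e}"
    unfolding bij_betw_def
  proof
    show "inj_on (\<lambda>u. {v, u}) (nbrs E v)"
      by (auto simp: inj_on_def doubleton_eq_iff)
    show "(\<lambda>u. {v, u}) ` nbrs E v = {e \<in> E. v \<in> e}"
    proof (intro equalityI subsetI)
      fix e assume e: "e \<in> {e \<in> E. v \<in> e}"
      then have "card e = 2" using E by (auto simp: simple_graphs_def)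
      then obtain x y where "e = {x, y}" by (auto simp: card_2_iff)
      with e show "e \<in> (\<lambda>u. {v, u}) ` nbrs E v"
        by (auto simp: nbrs_def insert_commute)
    qed (auto simp: nbrs_def)
  qed
  then show ?thesis unfolding deg_def by (rule bij_betw_same_card)
qed

lemma crossing_commute: "crossing E A B = crossing E B A"
  unfolding crossing_def by (metis insert_commute)

lemma finite_crossing: "E \<in> simple_graphs n \<Longrightarrow> finite (crossing E A B)"
  unfolding crossing_def using simple_graph_finite by simp

lemma bij_betw_crossing:
  assumes "A \<inter> B = {}"
  shows "bij_betw (\<lambda>(a, b). {a, b}) (SIGMA a:A. nbrs E a \<inter> B) (crossing E A B)"
  unfolding bij_betw_def
proof
  show "inj_on (\<lambda>(a, b). {a, b}) (SIGMA a:A. nbrs E a \<inter> B)"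
    using assms by (auto simp: inj_on_def doubleton_eq_iff)
qed (auto simp: crossing_def nbrs_def image_iff)

lemma card_crossing:
  assumes "A \<inter> B = {}" "finite A" "finite B"
  shows "card (crossing E A B) = (\<Sum>a\<in>A. card (nbrs E a \<inter> B))"
  using bij_betw_same_card[OF bij_betw_crossing[OF assms(1), of E]] assms by simp

section \<open>Switchings across a cut\<close>

text \<open>A pair \<open>((x, z), (y, w))\<close> records the two edges \<open>xy\<close> inside \<open>A\<close> and \<open>zw\<close> inside \<open>B\<close> that
  can be replaced by the crossing edges \<open>xw\<close> and \<open>yz\<close>. Grouping the coordinates as \<open>(x, z)\<close> and
  \<open>(y, w)\<close> makes the set a \<open>Sigma\<close> over the first pair.\<close>

definition switchings ::
    "nat set set \<Rightarrow> nat set \<Rightarrow> nat set \<Rightarrow> ((nat \<times> nat) \<times> (nat \<times> nat)) set" where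
  "switchings E A B =
     (SIGMA (x, z) : A \<times> B. (nbrs E x \<inter> A - nbrs E z) \<times> (nbrs E z \<inter> B - nbrs E x))"

fun switch :: "nat set set \<Rightarrow> (nat \<times> nat) \<times> (nat \<times> nat) \<Rightarrow> nat set set" where
  "switch E ((x, z), (y, w)) = (E - {{x, y}, {z, w}}) \<union> {{x, w}, {y, z}}"

definition sparse_cut_graphs ::
    "nat \<Rightarrow> (nat \<Rightarrow> nat) \<Rightarrow> nat set \<Rightarrow> nat set \<Rightarrow> nat \<Rightarrow> nat set set set" where
  "sparse_cut_graphs n ds A B t =
     {E \<in> graphs_with_degrees n ds. card (crossing E A B) \<le> t}"

lemma finite_graphs_with_degrees: "finite (graphs_with_degrees n ds)"
  unfolding graphs_with_degrees_def using finite_simple_graphs by auto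

lemma finite_sparse_cut_graphs: "finite (sparse_cut_graphs n ds A B t)"
  unfolding sparse_cut_graphs_def using finite_graphs_with_degrees by auto

lemma deg_insert:
  assumes "finite E" "e \<notin> E"
  shows "deg (insert e E) v = (if v \<in> e then 1 else 0) + deg E v"
proof -
  have "{e' \<in> insert e E. v \<in> e'} = (if v \<in> e then insert e {e' \<in> E. v \<in> e'} else {e' \<in> E. v \<in> e'})"
    by auto
  then show ?thesis using assms by (simp add: deg_def)
qed

lemma switching_facts:
  assumes E: "E \<in> simple_graphs n" and AB: "A \<inter> B = {}"
    and q: "((x, z), (y, w)) \<in> switchings E A B"
  shows "x \<in> A" "y \<in> A" "z \<in> B" "w \<in> B" "x \<noteq> y" "z \<noteq> w" "x \<noteq> z" "x \<noteq> w" "y \<noteq> z" "y \<noteq> w"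
    "{x, y} \<in> E" "{z, w} \<in> E" "{x, w} \<notin> E" "{y, z} \<notin> E"
proof -
  show 1: "x \<in> A" "y \<in> A" "z \<in> B" "w \<in> B" "{x, y} \<in> E" "{z, w} \<in> E" "{x, w} \<notin> E" "{y, z} \<notin> E"
    using q by (auto simp: switchings_def nbrs_def insert_commute)
  show "x \<noteq> y" "z \<noteq> w" using simple_graph_edge(1)[OF E] 1 by blast+
  show "x \<noteq> z" "x \<noteq> w" "y \<noteq> z" "y \<noteq> w" using 1 AB by blast+
qed

lemma switch_in_simple_graphs:
  assumes E: "E \<in> simple_graphs n" and AB: "A \<inter> B = {}"
    and q: "((x, z), (y, w)) \<in> switchings E A B"
  shows "switch E ((x, z), (y, w)) \<in> simple_graphs n"
proof -
  note f = switching_facts[OF assms]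
  have "x \<in> {1..n}" "y \<in> {1..n}" "z \<in> {1..n}" "w \<in> {1..n}"
    using simple_graph_edge[OF E f(11)] simple_graph_edge[OF E f(12)] by blast+
  then show ?thesis using E f(8,9) by (auto simp: simple_graphs_def)
qed

lemma deg_switch:
  assumes E: "E \<in> simple_graphs n" and AB: "A \<inter> B = {}"
    and q: "((x, z), (y, w)) \<in> switchings E A B"
  shows "deg (switch E ((x, z), (y, w))) v = deg E v"
proof -
  note f = switching_facts[OF assms]
  define F where "F = E - {{x, y}, {z, w}}"
  have F: "finite F" using simple_graph_finite[OF E] by (simp add: F_def)
  have 1: "E = insert {x, y} (insert {z, w} F)"
    using f(11,12) by (auto simp: F_def)
  have 2: "switch E ((x, z), (y, w)) = insert {x, w} (insert {y, z} F)"
    by (auto simp: F_def)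
  have n: "{z, w} \<notin> F" "{x, y} \<notin> insert {z, w} F" "{y, z} \<notin> F" "{x, w} \<notin> insert {y, z} F"
    using f by (auto simp: F_def doubleton_eq_iff)
  have "deg E v = (if v \<in> {x, y} then 1 else 0) + ((if v \<in> {z, w} then 1 else 0) + deg F v)"
    unfolding 1 using F n by (simp add: deg_insert del: insert_iff)
  moreover have "deg (switch E ((x, z), (y, w))) v
      = (if v \<in> {x, w} then 1 else 0) + ((if v \<in> {y, z} then 1 else 0) + deg F v)"
    unfolding 2 using F n by (simp add: deg_insert del: insert_iff)
  ultimately show ?thesis using f(5-10) by auto
qed

lemma card_crossing_switch:
  assumes E: "E \<in> simple_graphs n" and AB: "A \<inter> B = {}"
    and q: "((x, z), (y, w)) \<in> switchings E A B"
  shows "card (crossing (switch E ((x, z), (y, w))) A B) \<le> card (crossing E A B) + 2"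
proof -
  have "crossing (switch E ((x, z), (y, w))) A B \<subseteq> crossing E A B \<union> {{x, w}, {y, z}}"
    by (auto simp: crossing_def)
  then have "card (crossing (switch E ((x, z), (y, w))) A B)
      \<le> card (crossing E A B \<union> {{x, w}, {y, z}})"
    by (rule card_mono[rotated]) (use finite_crossing[OF E] in simp)
  also have "\<dots> \<le> card (crossing E A B) + card {{x, w}, {y, z}}" by (rule card_Un_le)
  also have "card {{x, w}, {y, z}} \<le> 2" by (simp add: card_insert_if)
  finally show ?thesis by simp
qed

text \<open>Double counting. A switching is undone by naming its two crossing edges, so a graph with at
  most \<open>t + 2\<close> crossing edges arises from at most \<open>(t + 2)\<^sup>2\<close> switchings. Counting graphs with
  \<^emph>\<open>at most\<close> \<open>t\<close> crossing edges, instead of exactly \<open>t\<close>, makes it irrelevant by how much a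
  switching raises their number.\<close>

lemma switching_double_count:
  assumes A: "finite A" and B: "finite B" and AB: "A \<inter> B = {}"
    and N: "\<And>E. E \<in> sparse_cut_graphs n ds A B t \<Longrightarrow> N \<le> real (card (switchings E A B))"
  shows "real (card (sparse_cut_graphs n ds A B t)) * N
           \<le> real (card (sparse_cut_graphs n ds A B (t + 2))) * (real (t + 2))\<^sup>2"
proof -
  define P where "P = (SIGMA E : sparse_cut_graphs n ds A B t. switchings E A B)"
  define C where "C E = (SIGMA a:A. nbrs E a \<inter> B)" for E
  define undo where "undo E = (\<lambda>((x, w), (y, z)). ((x, z), (y, w))) ` (C E \<times> C E)" for E
  define Q where "Q = (SIGMA E : sparse_cut_graphs n ds A B (t + 2). undo E)"
  define f where "f = (\<lambda>(E, q). (switch E q, q))"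
  have simple: "E \<in> simple_graphs n" if "E \<in> sparse_cut_graphs n ds A B s" for E s
    using that by (simp add: sparse_cut_graphs_def graphs_with_degrees_def)
  have fC: "finite (C E)" for E using A B by (simp add: C_def)
  have fsw: "finite (switchings E A B)" for E
    using A B unfolding switchings_def by (auto intro!: finite_SigmaI)
  have inj: "inj_on f P"
  proof (rule inj_onI)
    fix a b assume a: "a \<in> P" and b: "b \<in> P" and eq: "f a = f b"
    obtain E x z y w where a': "a = (E, ((x, z), (y, w)))" by (metis prod.collapse)
    with eq obtain E' where b': "b = (E', ((x, z), (y, w)))"
      by (cases b) (auto simp: f_def)
    have *: "G = (switch G ((x, z), (y, w)) - {{x, w}, {y, z}}) \<union> {{x, y}, {z, w}}"
      if "(G, ((x, z), (y, w))) \<in> P" for G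
    proof -
      have "G \<in> simple_graphs n" "((x, z), (y, w)) \<in> switchings G A B"
        using that simple by (auto simp: P_def)
      note g = switching_facts[OF this(1) AB this(2)]
      show ?thesis using g by (auto simp: doubleton_eq_iff)
    qed
    have "switch E ((x, z), (y, w)) = switch E' ((x, z), (y, w))"
      using eq by (simp add: f_def a' b')
    then have "E = E'" using *[of E] *[of E'] a b a' b' by metis
    then show "a = b" by (simp add: a' b')
  qed
  have sub: "f ` P \<subseteq> Q"
  proof
    fix r assume "r \<in> f ` P"
    then obtain E x z y w where r: "r = (switch E ((x, z), (y, w)), ((x, z), (y, w)))"
      and p: "(E, ((x, z), (y, w))) \<in> P" by (auto simp: f_def)
    have E: "E \<in> sparse_cut_graphs n ds A B t" and q: "((x, z), (y, w)) \<in> switchings E A B"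
      using p by (auto simp: P_def)
    note g = switching_facts[OF simple[OF E] AB q]
    have 1: "switch E ((x, z), (y, w)) \<in> sparse_cut_graphs n ds A B (t + 2)"
      using E card_crossing_switch[OF simple[OF E] AB q] deg_switch[OF simple[OF E] AB q]
        switch_in_simple_graphs[OF simple[OF E] AB q]
      by (auto simp: sparse_cut_graphs_def graphs_with_degrees_def simp del: switch.simps)
    have "(x, w) \<in> C (switch E ((x, z), (y, w)))" "(y, z) \<in> C (switch E ((x, z), (y, w)))"
      using g by (auto simp: C_def nbrs_def)
    then have "((x, z), (y, w)) \<in> undo (switch E ((x, z), (y, w)))"
      unfolding undo_def by (force simp del: switch.simps)
    with 1 show "r \<in> Q" by (simp add: r Q_def del: switch.simps)
  qed
  have fb: "finite (undo E)" for E using fC by (simp add: undo_def)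
  have "real (card (sparse_cut_graphs n ds A B t)) * N
      \<le> (\<Sum>E\<in>sparse_cut_graphs n ds A B t. real (card (switchings E A B)))"
    using N by (rule sum_bounded_below)
  also have "\<dots> = real (card P)"
    using fsw finite_sparse_cut_graphs by (simp add: P_def)
  also have "card P \<le> card Q"
    by (rule card_inj_on_le[OF inj sub])
       (auto simp: Q_def finite_sparse_cut_graphs fb intro!: finite_SigmaI)
  also have "card Q = (\<Sum>E\<in>sparse_cut_graphs n ds A B (t + 2). card (undo E))"
    using fb finite_sparse_cut_graphs by (simp add: Q_def)
  also have "\<dots> \<le> card (sparse_cut_graphs n ds A B (t + 2)) * (t + 2)\<^sup>2"
  proof (rule order_trans[OF sum_bounded_above])
    fix E assume E: "E \<in> sparse_cut_graphs n ds A B (t + 2)"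
    have "card (undo E) \<le> card (C E \<times> C E)"
      unfolding undo_def by (rule card_image_le) (use fC in simp)
    also have "\<dots> = (card (C E))\<^sup>2" by (simp add: card_cartesian_product power2_eq_square)
    also have "card (C E) = card (crossing E A B)"
      unfolding C_def by (rule bij_betw_same_card[OF bij_betw_crossing[OF AB]])
    also have "(card (crossing E A B))\<^sup>2 \<le> (t + 2)\<^sup>2"
      using E by (intro power_mono) (auto simp: sparse_cut_graphs_def)
    finally show "card (undo E) \<le> (t + 2)\<^sup>2" .
  qed simp
  finally show ?thesis by (simp only: of_nat_mult of_nat_power)
qed

text \<open>Markov's inequality for the number of neighbours across the cut: the vertices with more than
  \<open>d / 4\<close> of them account for that many crossing edges each, so there are at most \<open>a / 2\<close> of
  them.\<close>

lemma many_sparse_vertices: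
  assumes AB: "A \<inter> B = {}" and A: "finite A" and B: "finite B" and X: "X \<subseteq> A"
    and Xa: "real (card X) \<ge> a" and d: "d > 0"
    and k: "real (card (crossing E A B)) \<le> a * d / 8"
  shows "real (card {x \<in> X. real (card (nbrs E x \<inter> B)) \<le> d / 4}) \<ge> a / 2"
proof -
  let ?L = "{x \<in> X. real (card (nbrs E x \<inter> B)) \<le> d / 4}"
  let ?H = "{x \<in> X. real (card (nbrs E x \<inter> B)) > d / 4}"
  have fX: "finite X" using A X finite_subset by blast
  have "real (card ?H) * (d / 4) \<le> (\<Sum>x\<in>?H. real (card (nbrs E x \<inter> B)))"
    by (rule sum_bounded_below) auto
  also have "\<dots> \<le> (\<Sum>x\<in>A. real (card (nbrs E x \<inter> B)))"
    by (rule sum_mono2) (use A X in auto)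
  also have "\<dots> = real (card (crossing E A B))"
    using card_crossing[OF AB A B] by simp
  finally have "real (card ?H) * (d / 4) \<le> a / 2 * (d / 4)" using k by linarith
  then have H: "real (card ?H) \<le> a / 2" using d by (simp add: mult_le_cancel_right)
  have "card X = card (?L \<union> ?H)" by (rule arg_cong[of _ _ card]) auto
  also have "\<dots> = card ?L + card ?H" by (rule card_Un_disjoint) (use fX in auto)
  finally show ?thesis using H Xa by simp
qed

text \<open>The edges \<open>xy\<close>, \<open>zw\<close> can be switched iff \<open>y\<close> is not a neighbour of \<open>z\<close> and \<open>w\<close> is not one
  of \<open>x\<close>. Choosing \<open>x\<close> and \<open>z\<close> first is what makes this restriction harmless, however high some
  degrees may be: if \<open>x\<close> and \<open>z\<close> have degree at least \<open>d\<close> and at most \<open>d / 4\<close> neighbours across the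
  cut, then \<open>x\<close> has at least \<open>3 d / 4\<close> neighbours \<open>y\<close> on its own side, of which at most \<open>d / 4\<close>
  are neighbours of \<open>z\<close>. This leaves \<open>d / 2\<close> choices for \<open>y\<close>, likewise for \<open>w\<close>, and there are at
  least \<open>a / 2\<close> choices each for \<open>x\<close> and \<open>z\<close>.\<close>

lemma many_switchings:
  assumes E: "E \<in> graphs_with_degrees n ds" and AB: "A \<inter> B = {}" and U: "A \<union> B = {1..n}"
    and d: "d > 0" and a: "a \<ge> 0"
    and Aa: "real (card (A \<inter> S n ds d)) \<ge> a" and Ba: "real (card (B \<inter> S n ds d)) \<ge> a"
    and k: "real (card (crossing E A B)) \<le> a * d / 8"
  shows "a\<^sup>2 * d\<^sup>2 / 16 \<le> real (card (switchings E A B))"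
proof -
  have Es: "E \<in> simple_graphs n" and dg: "\<And>i. i \<in> {1..n} \<Longrightarrow> deg E i = ds i"
    using E by (auto simp: graphs_with_degrees_def)
  have A: "finite A" and B: "finite B" using U by (metis finite_Un finite_atLeastAtMost)+
  define X where "X = {x \<in> A \<inter> S n ds d. real (card (nbrs E x \<inter> B)) \<le> d / 4}"
  define Z where "Z = {z \<in> B \<inter> S n ds d. real (card (nbrs E z \<inter> A)) \<le> d / 4}"
  have X: "real (card X) \<ge> a / 2"
    unfolding X_def by (rule many_sparse_vertices[OF AB A B _ Aa d k]) auto
  have Z: "real (card Z) \<ge> a / 2"
    unfolding Z_def
    by (rule many_sparse_vertices[OF _ B A _ Ba d]) (use AB k crossing_commute in auto)
  have fin: "finite X" "finite Z" using A B by (auto simp: X_def Z_def)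
  have choices: "d / 2 \<le> real (card (nbrs E u \<inter> P - nbrs E v))"
    if PQ: "P \<inter> Q = {}" "P \<union> Q = {1..n}" and u: "u \<in> S n ds d"
      and uQ: "real (card (nbrs E u \<inter> Q)) \<le> d / 4" and vP: "real (card (nbrs E v \<inter> P)) \<le> d / 4"
    for P Q u v
  proof -
    have fn: "finite (nbrs E i)" for i using finite_nbrs[OF Es] .
    have "nbrs E u \<subseteq> (nbrs E u \<inter> P - nbrs E v) \<union> (nbrs E u \<inter> Q) \<union> (nbrs E v \<inter> P)"
      using nbrs_subset[OF Es] PQ(2) by blast
    then have "card (nbrs E u)
        \<le> card ((nbrs E u \<inter> P - nbrs E v) \<union> (nbrs E u \<inter> Q) \<union> (nbrs E v \<inter> P))"
      by (rule card_mono[rotated]) (use fn in auto)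
    also have "\<dots> \<le> card (nbrs E u \<inter> P - nbrs E v) + card (nbrs E u \<inter> Q) + card (nbrs E v \<inter> P)"
      by (meson card_Un_le le_trans add_le_mono1)
    finally have "card (nbrs E u) \<le> \<dots>" .
    moreover have "d \<le> real (card (nbrs E u))"
      using u dg card_nbrs[OF Es] by (auto simp: S_def)
    ultimately show ?thesis using uQ vP by linarith
  qed
  let ?R = "SIGMA (x, z) : X \<times> Z. (nbrs E x \<inter> A - nbrs E z) \<times> (nbrs E z \<inter> B - nbrs E x)"
  have "a\<^sup>2 * d\<^sup>2 / 16 = (a / 2 * (a / 2)) * (d / 2 * (d / 2))"
    by (simp add: power2_eq_square)
  also have "\<dots> \<le> (real (card X) * real (card Z)) * (d / 2 * (d / 2))"
    using X Z a by (intro mult_right_mono mult_mono) auto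
  also have "\<dots> = real (card (X \<times> Z)) * (d / 2 * (d / 2))"
    by (simp add: card_cartesian_product)
  also have "\<dots> \<le> (\<Sum>q\<in>X \<times> Z. real (card (case q of (x, z) \<Rightarrow>
                   (nbrs E x \<inter> A - nbrs E z) \<times> (nbrs E z \<inter> B - nbrs E x))))"
  proof (rule sum_bounded_below)
    fix q assume "q \<in> X \<times> Z"
    then obtain x z where q: "q = (x, z)" "x \<in> X" "z \<in> Z" by auto
    have 1: "d / 2 \<le> real (card (nbrs E x \<inter> A - nbrs E z))"
      by (rule choices[of A B]) (use AB U q in \<open>auto simp: X_def Z_def\<close>)
    have 2: "d / 2 \<le> real (card (nbrs E z \<inter> B - nbrs E x))"
      by (rule choices[of B A]) (use AB U q in \<open>auto simp: X_def Z_def\<close>)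
    show "d / 2 * (d / 2) \<le> real (card (case q of (x, z) \<Rightarrow>
                   (nbrs E x \<inter> A - nbrs E z) \<times> (nbrs E z \<inter> B - nbrs E x)))"
      using mult_mono[OF 1 2] d by (simp add: q card_cartesian_product)
  qed
  also have "\<dots> = real (card ?R)"
    using fin finite_nbrs[OF Es] A B by (subst card_SigmaI) auto
  also have "card ?R \<le> card (switchings E A B)"
  proof (rule card_mono)
    show "finite (switchings E A B)"
      using A B unfolding switchings_def by (auto intro!: finite_SigmaI)
    show "?R \<subseteq> switchings E A B"
      unfolding switchings_def by (rule Sigma_mono) (auto simp: X_def Z_def)
  qed
  finally show ?thesis by simp
qed

text \<open>The range of \<open>t\<close> is such that the \<open>a\<^sup>2 d\<^sup>2 / 16\<close> switchings leaving a graph are at least \<open>4\<close>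
  times the \<open>(t + 2)\<^sup>2 \<le> a\<^sup>2 d\<^sup>2 / 64\<close> switchings that can lead to one.\<close>

lemma sparse_cut_graphs_step:
  assumes AB: "A \<inter> B = {}" and U: "A \<union> B = {1..n}"
    and d: "d > 0" and a: "a > 0"
    and Aa: "real (card (A \<inter> S n ds d)) \<ge> a" and Ba: "real (card (B \<inter> S n ds d)) \<ge> a"
    and t: "real (t + 2) \<le> a * d / 8"
  shows "4 * real (card (sparse_cut_graphs n ds A B t))
           \<le> real (card (sparse_cut_graphs n ds A B (t + 2)))"
proof -
  have A: "finite A" and B: "finite B" using U by (metis finite_Un finite_atLeastAtMost)+
  have "real (card (sparse_cut_graphs n ds A B t)) * (a\<^sup>2 * d\<^sup>2 / 16)
      \<le> real (card (sparse_cut_graphs n ds A B (t + 2))) * (real (t + 2))\<^sup>2"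
  proof (rule switching_double_count[OF A B AB])
    fix E assume "E \<in> sparse_cut_graphs n ds A B t"
    then show "a\<^sup>2 * d\<^sup>2 / 16 \<le> real (card (switchings E A B))"
      using a t by (intro many_switchings[OF _ AB U d _ Aa Ba]) (auto simp: sparse_cut_graphs_def)
  qed
  also have "\<dots> \<le> real (card (sparse_cut_graphs n ds A B (t + 2))) * (a * d / 8)\<^sup>2"
    using t by (intro mult_left_mono power_mono) auto
  finally have "4 * real (card (sparse_cut_graphs n ds A B t)) * (a\<^sup>2 * d\<^sup>2)
      \<le> real (card (sparse_cut_graphs n ds A B (t + 2))) * (a\<^sup>2 * d\<^sup>2)"
    by (simp add: power_divide power_mult_distrib mult_ac)
  then show ?thesis using a d by (simp add: mult_le_cancel_right)
qed

lemma sparse_cut_graphs_iterate: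
  assumes AB: "A \<inter> B = {}" and U: "A \<union> B = {1..n}"
    and d: "d > 0" and a: "a > 0"
    and Aa: "real (card (A \<inter> S n ds d)) \<ge> a" and Ba: "real (card (B \<inter> S n ds d)) \<ge> a"
    and t: "real (t + 2 * j) \<le> a * d / 8"
  shows "4 ^ j * real (card (sparse_cut_graphs n ds A B t))
           \<le> real (card (sparse_cut_graphs n ds A B (t + 2 * j)))"
  using t
proof (induction j)
  case (Suc j)
  have "4 ^ Suc j * real (card (sparse_cut_graphs n ds A B t))
      \<le> 4 * real (card (sparse_cut_graphs n ds A B (t + 2 * j)))"
    using Suc by simp
  also have "\<dots> \<le> real (card (sparse_cut_graphs n ds A B (t + 2 * j + 2)))"
    by (rule sparse_cut_graphs_step[OF AB U d a Aa Ba]) (use Suc.prems in simp)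
  finally show ?case by simp
qed simp

section \<open>Percolation of a random graph\<close>

text \<open>Conditioning on the graph: it is allowed to be atypical (in \<open>B\<close>), and otherwise the
  percolated graph has to behave well uniformly in the graph.\<close>

lemma prob_bind_pmf_le:
  assumes b: "b \<ge> 0" and f: "\<And>x. x \<in> set_pmf M \<Longrightarrow> x \<notin> B \<Longrightarrow> measure_pmf.prob (f x) A \<le> b"
  shows "measure_pmf.prob (bind_pmf M f) A \<le> measure_pmf.prob M B + b"
proof -
  have "emeasure (bind_pmf M f) A = (\<integral>\<^sup>+x. emeasure (f x) A \<partial>M)" by simp
  also have "\<dots> \<le> (\<integral>\<^sup>+x. indicator B x + ennreal b \<partial>M)"
  proof (rule nn_integral_mono_AE, rule AE_pmfI)
    fix x assume x: "x \<in> set_pmf M"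
    show "emeasure (f x) A \<le> indicator B x + ennreal b"
    proof (cases "x \<in> B")
      case True
      then show ?thesis
        using measure_pmf.emeasure_le_1[of "f x" A] by (simp add: add_increasing2)
    next
      case False
      then show ?thesis
        using f[OF x] by (simp add: measure_pmf.emeasure_eq_measure ennreal_leI)
    qed
  qed
  also have "\<dots> = emeasure M B + ennreal b"
    by (subst nn_integral_add) auto
  also have "\<dots> = ennreal (measure_pmf.prob M B + b)"
    using b by (simp add: measure_pmf.emeasure_eq_measure)
  finally show ?thesis
    using b by (simp add: measure_pmf.emeasure_eq_measure del: ennreal_plus)
qed

text \<open>Markov's inequality for the number of events that occur.\<close>

lemma prob_many_events_le:
  assumes V: "finite V" and a: "a > 0" and q: "\<And>v. v \<in> V \<Longrightarrow> measure_pmf.prob M (A v) \<le> q"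
  shows "measure_pmf.prob M {x. a \<le> real (card {v \<in> V. x \<in> A v})} \<le> real (card V) * q / a"
proof -
  let ?X = "{x. a \<le> real (card {v \<in> V. x \<in> A v})}"
  have int: "integrable (measure_pmf M) (indicat_real B)" for B
    by (rule measure_pmf.integrable_const_bound[where B = 1]) (auto split: split_indicator)
  have "a * measure_pmf.prob M ?X = measure_pmf.expectation M (\<lambda>x. a * indicat_real ?X x)"
    by simp
  also have "\<dots> \<le> measure_pmf.expectation M (\<lambda>x. \<Sum>v\<in>V. indicat_real (A v) x)"
  proof (rule integral_mono)
    fix x
    have "(\<Sum>v\<in>V. indicat_real (A v) x) = real (card {v \<in> V. x \<in> A v})"
      using V by (simp add: indicator_def sum.If_cases Int_def)
    then show "a * indicat_real ?X x \<le> (\<Sum>v\<in>V. indicat_real (A v) x)"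
      by (simp split: split_indicator)
  qed (use int in auto)
  also have "\<dots> = (\<Sum>v\<in>V. measure_pmf.prob M (A v))"
    by (subst Bochner_Integration.integral_sum) (use int in auto)
  also have "\<dots> \<le> real (card V) * q"
    using q by (rule sum_bounded_above)
  finally show ?thesis using a by (simp add: field_simps)
qed

lemma percolate_subset: "finite E \<Longrightarrow> F \<in> set_pmf (percolate p E) \<Longrightarrow> F \<subseteq> E"
  by (auto simp: percolate_def)

lemma prob_percolate_avoids:
  assumes E: "finite E" and C: "C \<subseteq> E" and p: "p \<in> {0..1}"
  shows "measure_pmf.prob (percolate p E) {F. F \<inter> C = {}} = (1 - p) ^ card C"
proof -
  let ?B = "\<lambda>e. if e \<in> C then {False} else UNIV"
  have "(\<lambda>keep. {e \<in> E. keep e}) -` {F. F \<inter> C = {}} = Pi E ?B"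
    using C by (auto simp: Pi_def)
  then have "measure_pmf.prob (percolate p E) {F. F \<inter> C = {}}
      = (\<Prod>e\<in>E. measure_pmf.prob (bernoulli_pmf p) (?B e))"
    unfolding percolate_def by (simp add: measure_Pi_pmf_Pi[OF E])
  also have "\<dots> = (\<Prod>e\<in>E. if e \<in> C then 1 - p else 1)"
    using p by (intro prod.cong) (auto simp: measure_pmf_single)
  also have "\<dots> = (1 - p) ^ card C"
    using E C by (simp add: prod.If_cases Int_absorb1)
  finally show ?thesis .
qed

lemma prob_percolate_meets:
  assumes E: "finite E" and C: "C \<subseteq> E" and p: "p \<in> {0..1}"
  shows "measure_pmf.prob (percolate p E) {F. F \<inter> C \<noteq> {}} \<le> real (card C) * p"
proof -
  have "{F. F \<inter> C \<noteq> {}} = space (percolate p E) - {F. F \<inter> C = {}}" by auto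
  then have "measure_pmf.prob (percolate p E) {F. F \<inter> C \<noteq> {}} = 1 - (1 - p) ^ card C"
    using measure_pmf.prob_compl[of "{F. F \<inter> C = {}}" "percolate p E"]
      prob_percolate_avoids[OF assms] by simp
  also have "\<dots> \<le> real (card C) * p"
    using Bernoulli_inequality[of "- p" "card C"] p by simp
  finally show ?thesis .
qed

lemma set_random_graph:
  assumes "feasible n ds"
  shows "set_pmf (random_graph n ds) = graphs_with_degrees n ds"
  using assms finite_graphs_with_degrees by (simp add: random_graph_def feasible_def)

lemma set_percolated_random_graph:
  assumes "feasible n ds" and "F \<in> set_pmf (percolated_random_graph n ds p)"
  shows "F \<in> simple_graphs n"
proof -
  obtain E where E: "E \<in> simple_graphs n" "F \<in> set_pmf (percolate p E)"
    using assms by (auto simp: percolated_random_graph_def set_random_graph graphs_with_degrees_def)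
  then show ?thesis
    using percolate_subset simple_graph_finite simple_graph_subset by metis
qed

section \<open>Components\<close>

lemma connected_rel_iff:
  "(v, u) \<in> connected_rel n E \<longleftrightarrow>
     v \<in> {1..n} \<and> u \<in> {1..n} \<and> (v, u) \<in> {(x, y). {x, y} \<in> E}\<^sup>*"
  by (auto simp: connected_rel_def)

lemma component_cases:
  assumes "C \<in> graph_components n E"
  obtains v where "v \<in> {1..n}" "C = connected_rel n E `` {v}"
  using assms unfolding graph_components_def by (auto elim: quotientE)

lemma component_subset: "C \<in> graph_components n E \<Longrightarrow> C \<subseteq> {1..n}"
  by (auto elim!: component_cases simp: connected_rel_iff)

lemma finite_graph_components: "finite (graph_components n E)"
  by (rule finite_subset[of _ "Pow {1..n}"]) (use component_subset in auto)

lemma card_component_le_L1: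
  assumes "C \<in> graph_components n E"
  shows "card C \<le> L1 n E"
  unfolding L1_def using assms finite_graph_components by (intro Max_ge) auto

lemma component_non_isolated:
  assumes C: "C \<in> graph_components n E" and u: "u \<in> C" "u' \<in> C" "u \<noteq> u'"
  shows "\<exists>e\<in>E. u \<in> e"
proof -
  let ?R = "{(x, y). {x, y} \<in> E}"
  obtain v where v: "C = connected_rel n E `` {v}" using C by (rule component_cases)
  have "sym (?R\<^sup>*)" by (rule sym_rtrancl) (auto simp: sym_def insert_commute)
  then have "(u, v) \<in> ?R\<^sup>*" "(v, u') \<in> ?R\<^sup>*"
    using u v by (auto simp: connected_rel_iff dest: symD)
  then have "(u, u') \<in> ?R\<^sup>*" by (rule rtrancl_trans)
  then obtain y where "(u, y) \<in> ?R" using u(3) by (auto elim: converse_rtranclE)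
  then show ?thesis by auto
qed

text \<open>Every vertex of a component with at least two vertices has an edge. The summand \<open>1\<close>
  accounts for graphs all of whose components are singletons.\<close>

lemma L1_le:
  assumes n: "n \<ge> 1"
  shows "L1 n E \<le> card (T \<inter> {1..n}) + card {v \<in> {1..n} - T. \<exists>e\<in>E. v \<in> e} + 1"
  unfolding L1_def
proof (rule Max.boundedI)
  show "finite (card ` graph_components n E)" using finite_graph_components by simp
  show "card ` graph_components n E \<noteq> {}"
    using n by (auto simp: graph_components_def quotient_def)
next
  fix c assume "c \<in> card ` graph_components n E"
  then obtain C where C: "C \<in> graph_components n E" and c: "c = card C" by auto
  let ?Y = "{v \<in> {1..n} - T. \<exists>e\<in>E. v \<in> e}"
  have fC: "finite C" using component_subset[OF C] finite_subset by blast
  show "c \<le> card (T \<inter> {1..n}) + card ?Y + 1"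
  proof (cases "card C \<le> 1")
    case False
    have "C \<subseteq> (T \<inter> {1..n}) \<union> ?Y"
    proof
      fix u assume u: "u \<in> C"
      have "C \<noteq> {u}" using False by auto
      then obtain u' where "u' \<in> C" "u' \<noteq> u" using u by auto
      then have "\<exists>e\<in>E. u \<in> e" using component_non_isolated[OF C u, of u'] by simp
      moreover have "u \<in> {1..n}" using component_subset[OF C] u by auto
      ultimately show "u \<in> (T \<inter> {1..n}) \<union> ?Y" by auto
    qed
    then have "card C \<le> card ((T \<inter> {1..n}) \<union> ?Y)" by (intro card_mono) auto
    also have "\<dots> \<le> card (T \<inter> {1..n}) + card ?Y" by (rule card_Un_le)
    finally show ?thesis by (simp add: c)
  qed (simp add: c)
qed

text \<open>Take a smallest union of components \<open>A\<close> with at least \<open>a\<close> vertices of \<open>T\<close>.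
  Removing any one component \<open>C\<close> from it leaves fewer than \<open>a\<close>; so if every component missed more
  than \<open>2a\<close> vertices of \<open>T\<close>, then \<open>A\<close> would miss more than \<open>a\<close> of them, and \<open>A\<close> would be a cut
  without crossing edges that has at least \<open>a\<close> vertices of \<open>T\<close> on both sides.\<close>

lemma component_of_uncut_set:
  assumes E: "E \<in> simple_graphs n" and T: "T \<subseteq> {1..n}"
    and a: "a > 0" and Ta: "real (card T) \<ge> a"
    and cut: "\<And>A. A \<subseteq> {1..n} \<Longrightarrow> real (card (A \<inter> T)) \<ge> a
                \<Longrightarrow> real (card (({1..n} - A) \<inter> T)) \<ge> a \<Longrightarrow> crossing E A ({1..n} - A) \<noteq> {}"
  shows "\<exists>C\<in>graph_components n E. real (card (C \<inter> T)) \<ge> real (card T) - 2 * a"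
proof (rule ccontr)
  assume no: "\<not> ?thesis"
  define P where
    "P A \<longleftrightarrow> A \<subseteq> {1..n} \<and> crossing E A ({1..n} - A) = {} \<and> real (card (A \<inter> T)) \<ge> a" for A
  have "P {1..n}" using T Ta by (simp add: P_def crossing_def Int_absorb1)
  then obtain A where A: "P A" and min: "\<And>A'. card A' < card A \<Longrightarrow> \<not> P A'"
    using exists_least_iff[of "\<lambda>k. \<exists>A. P A \<and> card A = k"] by metis
  have AT: "A \<subseteq> {1..n}" "crossing E A ({1..n} - A) = {}" "real (card (A \<inter> T)) \<ge> a"
    using A by (auto simp: P_def)
  have fA: "finite A" using AT(1) finite_subset by blast
  have fT: "finite T" using T finite_subset by blast
  have "A \<inter> T \<noteq> {}" using AT(3) a by auto
  then obtain v where v: "v \<in> A" by auto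
  define C where "C = connected_rel n E `` {v}"
  have C: "C \<in> graph_components n E"
    using v AT(1) unfolding C_def graph_components_def by (intro quotientI) auto
  have closed: "y \<in> A" if xy: "x \<in> A" "{x, y} \<in> E" for x y
  proof (rule ccontr)
    assume "y \<notin> A"
    then have "{x, y} \<in> crossing E A ({1..n} - A)"
      using xy simple_graph_edge(3)[OF E xy(2)] unfolding crossing_def by blast
    then show False using AT(2) by simp
  qed
  have CA: "C \<subseteq> A"
  proof
    fix u assume "u \<in> C"
    then have "(v, u) \<in> {(x, y). {x, y} \<in> E}\<^sup>*" by (simp add: C_def connected_rel_iff)
    then show "u \<in> A" by (induction rule: rtrancl_induct) (use v closed in auto)
  qed
  have vC: "v \<in> C" using v AT(1) by (auto simp: C_def connected_rel_iff)
  have Cclosed: "y \<in> C" if "x \<in> C" "{x, y} \<in> E" for x y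
    using that simple_graph_edge(3)[OF E that(2)]
    by (auto simp: C_def connected_rel_iff intro: rtrancl_into_rtrancl)
  have "crossing E (A - C) ({1..n} - (A - C)) = {}"
  proof (rule ccontr)
    assume "\<not> ?thesis"
    then obtain x y where xy: "{x, y} \<in> E" "x \<in> A" "x \<notin> C" "y \<notin> A - C"
      unfolding crossing_def by blast
    then have "y \<in> C" using closed by blast
    then show False using Cclosed[of y x] xy by (simp add: insert_commute)
  qed
  moreover have "card (A - C) < card A" using v vC fA by (intro psubset_card_mono) auto
  ultimately have "real (card ((A - C) \<inter> T)) < a"
    using min[of "A - C"] AT(1) by (auto simp: P_def)
  moreover have "card (A \<inter> T) = card ((A - C) \<inter> T) + card (C \<inter> T)"
  proof -
    have "A \<inter> T = ((A - C) \<inter> T) \<union> (C \<inter> T)" using CA by auto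
    then have "card (A \<inter> T) = card (((A - C) \<inter> T) \<union> (C \<inter> T))" by simp
    also have "\<dots> = card ((A - C) \<inter> T) + card (C \<inter> T)"
      by (rule card_Un_disjoint) (use fT in auto)
    finally show ?thesis .
  qed
  moreover have "real (card (C \<inter> T)) < real (card T) - 2 * a" using no C by force
  moreover have "card T = card (A \<inter> T) + card (({1..n} - A) \<inter> T)"
  proof -
    have "T = (A \<inter> T) \<union> (({1..n} - A) \<inter> T)" using T by auto
    then have "card T = card ((A \<inter> T) \<union> (({1..n} - A) \<inter> T))" by simp
    also have "\<dots> = card (A \<inter> T) + card (({1..n} - A) \<inter> T)"
      by (rule card_Un_disjoint) (use fT in auto)
    finally show ?thesis .
  qed
  ultimately have "real (card (({1..n} - A) \<inter> T)) \<ge> a" by linarith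
  then show False using cut[OF AT(1,3)] AT(2) by simp
qed

section \<open>The two regimes at fixed size\<close>

lemma S_subset: "S n ds x \<subseteq> {1..n}"
  by (auto simp: S_def)

lemma prob_L1_large_le:
  assumes feas: "feasible n ds" and n: "n \<ge> 1" and d: "d > 0" and p: "p \<in> {0..1}" and a: "a > 0"
  shows "measure_pmf.prob (percolated_random_graph n ds p)
           {E. real (L1 n E) \<ge> real (card (S n ds d)) + 1 + a} \<le> real n * (p * d) / a"
proof -
  have "measure_pmf.prob (percolated_random_graph n ds p)
           {E. real (L1 n E) \<ge> real (card (S n ds d)) + 1 + a}
        \<le> measure_pmf.prob (random_graph n ds) {} + real n * (p * d) / a"
    unfolding percolated_random_graph_def
  proof (rule prob_bind_pmf_le)
    show "0 \<le> real n * (p * d) / a" using p d a by simp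
  next
    fix E assume "E \<in> set_pmf (random_graph n ds)"
    then have E: "E \<in> simple_graphs n" and dg: "\<And>i. i \<in> {1..n} \<Longrightarrow> deg E i = ds i"
      by (auto simp: set_random_graph[OF feas] graphs_with_degrees_def)
    have fE: "finite E" by (rule simple_graph_finite[OF E])
    let ?V = "{1..n} - S n ds d"
    let ?A = "\<lambda>v. {F. F \<inter> {e \<in> E. v \<in> e} \<noteq> {}}"
    have "measure_pmf.prob (percolate p E) {F. real (L1 n F) \<ge> real (card (S n ds d)) + 1 + a}
        \<le> measure_pmf.prob (percolate p E) {F. a \<le> real (card {v \<in> ?V. F \<in> ?A v})}"
    proof (rule measure_pmf.finite_measure_mono_AE, rule AE_pmfI, rule impI)
      fix F assume "F \<in> set_pmf (percolate p E)"
        and L: "F \<in> {F. real (L1 n F) \<ge> real (card (S n ds d)) + 1 + a}"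
      then have "F \<subseteq> E" using percolate_subset[OF fE] by blast
      then have "{v \<in> ?V. F \<in> ?A v} = {v \<in> ?V. \<exists>e\<in>F. v \<in> e}" by blast
      then show "F \<in> {F. a \<le> real (card {v \<in> ?V. F \<in> ?A v})}"
        using L L1_le[OF n, of F "S n ds d"] S_subset[of n ds d] by (simp add: Int_absorb2)
    qed simp
    also have "\<dots> \<le> real (card ?V) * (p * d) / a"
    proof (rule prob_many_events_le[OF _ a])
      fix v assume v: "v \<in> ?V"
      have "measure_pmf.prob (percolate p E) (?A v) \<le> real (card {e \<in> E. v \<in> e}) * p"
        by (rule prob_percolate_meets[OF fE _ p]) auto
      also have "card {e \<in> E. v \<in> e} = ds v" using dg v by (simp add: deg_def)
      also have "real (ds v) * p \<le> d * p"
        using v p by (intro mult_right_mono) (auto simp: S_def)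
      finally show "measure_pmf.prob (percolate p E) (?A v) \<le> p * d" by (simp add: mult.commute)
    qed simp
    also have "\<dots> \<le> real n * (p * d) / a"
    proof (intro divide_right_mono mult_right_mono)
      have "card ?V \<le> card {1..n}" by (rule card_mono) auto
      then show "real (card ?V) \<le> real n" by simp
    qed (use p d a in auto)
    finally show "measure_pmf.prob (percolate p E)
        {F. real (L1 n F) \<ge> real (card (S n ds d)) + 1 + a} \<le> real n * (p * d) / a" .
  qed
  then show ?thesis by simp
qed

text \<open>Starting from \<open>a d / 16\<close> crossing edges there is room for about \<open>a d / 32\<close> steps of size
  \<open>2\<close> below the limit \<open>a d / 8\<close>, each of which gains a factor of \<open>4 \<ge> exp 1\<close>.\<close>

lemma prob_sparse_cut_le:
  assumes feas: "feasible n ds" and AB: "A \<inter> B = {}" and U: "A \<union> B = {1..n}"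
    and d: "d > 0" and a: "a > 0"
    and Aa: "real (card (A \<inter> S n ds d)) \<ge> a" and Ba: "real (card (B \<inter> S n ds d)) \<ge> a"
  shows "measure_pmf.prob (random_graph n ds)
           {E. real (card (crossing E A B)) < a * d / 16} \<le> 3 * exp (- (a * d / 32))"
proof -
  define K where "K = nat \<lfloor>a * d / 16\<rfloor>"
  define j where "j = nat \<lfloor>a * d / 32\<rfloor>"
  have ad: "a * d > 0" using a d by simp
  have K: "real K \<le> a * d / 16" and j: "real j \<le> a * d / 32" "real j \<ge> a * d / 32 - 1"
    using ad unfolding K_def j_def by linarith+
  let ?G = "graphs_with_degrees n ds" and ?F = "sparse_cut_graphs n ds A B"
  have G: "?G \<noteq> {}" "finite ?G" using feas finite_graphs_with_degrees by (auto simp: feasible_def)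
  have cG: "real (card ?G) > 0" using G by (simp add: card_gt_0_iff)
  \<comment> \<open>The rounding of \<open>j\<close> loses at most one step, which costs the factor \<open>exp 1 \<le> 3\<close> below.\<close>
  have "4 ^ j * real (card (?F K)) \<le> real (card (?F (K + 2 * j)))"
    by (rule sparse_cut_graphs_iterate[OF AB U d a Aa Ba]) (use K j in simp)
  also have "\<dots> \<le> real (card ?G)"
    using G by (simp add: sparse_cut_graphs_def card_mono)
  finally have *: "real (card (?F K)) / real (card ?G) \<le> (1 / 4) ^ j"
    using cG by (simp add: field_simps power_divide)
  have "measure_pmf.prob (random_graph n ds) {E. real (card (crossing E A B)) < a * d / 16}
      = real (card (?G \<inter> {E. real (card (crossing E A B)) < a * d / 16})) / real (card ?G)"
    unfolding random_graph_def by (rule measure_pmf_of_set[OF G])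
  also have "\<dots> \<le> real (card (?F K)) / real (card ?G)"
  proof (intro divide_right_mono of_nat_mono card_mono)
    show "?G \<inter> {E. real (card (crossing E A B)) < a * d / 16} \<subseteq> ?F K"
      unfolding sparse_cut_graphs_def K_def by (auto simp: le_nat_floor)
  qed (auto simp: finite_sparse_cut_graphs)
  also have "\<dots> \<le> (1 / 4) ^ j" by (rule *)
  also have "\<dots> \<le> exp (- 1) ^ j"
    using exp_le by (intro power_mono) (auto simp: exp_minus field_simps)
  also have "\<dots> = exp (- real j)" by (simp add: exp_of_nat_mult[symmetric])
  also have "\<dots> \<le> exp (1 + - (a * d / 32))" using j by simp
  also have "\<dots> = exp 1 * exp (- (a * d / 32))" by (rule exp_add)
  also have "\<dots> \<le> 3 * exp (- (a * d / 32))" using exp_le by (intro mult_right_mono) auto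
  finally show ?thesis .
qed

text \<open>Either the graph has few edges across the cut, or many edges have to be deleted. In the
  second case at least \<open>p a d / 16\<close> crossing edges survive on average, and all of them are lost
  with probability at most \<open>exp (- p a d / 16)\<close>.\<close>

lemma prob_cut_dies_le:
  assumes feas: "feasible n ds" and AB: "A \<inter> B = {}" and U: "A \<union> B = {1..n}"
    and d: "d > 0" and a: "a > 0" and p: "p \<in> {0..1}"
    and Aa: "real (card (A \<inter> S n ds d)) \<ge> a" and Ba: "real (card (B \<inter> S n ds d)) \<ge> a"
  shows "measure_pmf.prob (percolated_random_graph n ds p) {E. crossing E A B = {}}
           \<le> 4 * exp (- (p * (a * d) / 32))"
proof -
  have ad: "a * d > 0" using a d by simp
  have pad: "p * (a * d) \<le> a * d" "0 \<le> p * (a * d)"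
    using p ad by (auto simp: mult_left_le_one_le)
  let ?B = "{E. real (card (crossing E A B)) < a * d / 16}"
  have "measure_pmf.prob (percolated_random_graph n ds p) {E. crossing E A B = {}}
      \<le> measure_pmf.prob (random_graph n ds) ?B + exp (- (p * (a * d) / 16))"
    unfolding percolated_random_graph_def
  proof (rule prob_bind_pmf_le)
    fix E assume "E \<in> set_pmf (random_graph n ds)" and EB: "E \<notin> ?B"
    then have E: "E \<in> simple_graphs n"
      by (auto simp: set_random_graph[OF feas] graphs_with_degrees_def)
    have fE: "finite E" by (rule simple_graph_finite[OF E])
    let ?C = "crossing E A B"
    have "measure_pmf.prob (percolate p E) {F. crossing F A B = {}}
        \<le> measure_pmf.prob (percolate p E) {F. F \<inter> ?C = {}}"
    proof (rule measure_pmf.finite_measure_mono_AE, rule AE_pmfI, rule impI)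
      fix F assume "F \<in> {F. crossing F A B = {}}"
      then show "F \<in> {F. F \<inter> ?C = {}}" by (auto simp: crossing_def)
    qed simp
    also have "\<dots> = (1 - p) ^ card ?C"
      by (rule prob_percolate_avoids[OF fE _ p]) (auto simp: crossing_def)
    also have "\<dots> \<le> exp (- p) ^ card ?C"
      using p exp_ge_add_one_self[of "- p"] by (intro power_mono) auto
    also have "\<dots> = exp (- (p * real (card ?C)))"
      by (simp add: exp_of_nat_mult[symmetric] mult.commute)
    also have "\<dots> \<le> exp (- (p * (a * d / 16)))"
      using EB p mult_left_mono[of "a * d / 16" "real (card ?C)" p] by simp
    finally show "measure_pmf.prob (percolate p E) {F. crossing F A B = {}}
        \<le> exp (- (p * (a * d) / 16))" by simp
  qed simp
  also have "measure_pmf.prob (random_graph n ds) ?B \<le> 3 * exp (- (a * d / 32))"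
    by (rule prob_sparse_cut_le[OF feas AB U d a Aa Ba])
  also have "exp (- (a * d / 32)) \<le> exp (- (p * (a * d) / 32))"
    using pad by (simp add: mult_ac)
  also have "exp (- (p * (a * d) / 16)) \<le> exp (- (p * (a * d) / 32))"
    using pad by (simp add: mult_ac)
  finally show ?thesis by simp
qed

lemma prob_giant_ge:
  assumes feas: "feasible n ds" and d: "d > 0" and a: "a > 0" and p: "p \<in> {0..1}"
    and Sa: "real (card (S n ds d)) \<ge> a"
  shows "measure_pmf.prob (percolated_random_graph n ds p)
           {E. \<exists>C\<in>graph_components n E.
                 real (card (C \<inter> S n ds d)) \<ge> real (card (S n ds d)) - 2 * a}
         \<ge> 1 - 2 ^ n * (4 * exp (- (p * (a * d) / 32)))"
proof -
  let ?M = "percolated_random_graph n ds p"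
  let ?good = "{E. \<exists>C\<in>graph_components n E.
                 real (card (C \<inter> S n ds d)) \<ge> real (card (S n ds d)) - 2 * a}"
  let ?cuts = "{A \<in> Pow {1..n}. real (card (A \<inter> S n ds d)) \<ge> a
                  \<and> real (card (({1..n} - A) \<inter> S n ds d)) \<ge> a}"
  let ?dead = "\<lambda>A. {E. crossing E A ({1..n} - A) = {}}"
  let ?q = "4 * exp (- (p * (a * d) / 32))"
  have "1 - measure_pmf.prob ?M ?good = measure_pmf.prob ?M (- ?good)"
    using measure_pmf.prob_compl[of ?good ?M] by (simp add: Compl_eq_Diff_UNIV)
  also have "\<dots> \<le> measure_pmf.prob ?M (\<Union>A\<in>?cuts. ?dead A)"
  proof (rule measure_pmf.finite_measure_mono_AE, rule AE_pmfI, rule impI)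
    fix E assume E: "E \<in> set_pmf ?M" and bad: "E \<in> - ?good"
    show "E \<in> (\<Union>A\<in>?cuts. ?dead A)"
    proof (rule ccontr)
      assume "E \<notin> (\<Union>A\<in>?cuts. ?dead A)"
      then have "\<exists>C\<in>graph_components n E.
          real (card (C \<inter> S n ds d)) \<ge> real (card (S n ds d)) - 2 * a"
        by (intro component_of_uncut_set[OF set_percolated_random_graph[OF feas E] S_subset a Sa])
           auto
      then show False using bad by simp
    qed
  qed simp
  also have "\<dots> \<le> (\<Sum>A\<in>?cuts. measure_pmf.prob ?M (?dead A))"
    by (rule measure_pmf.finite_measure_subadditive_finite) auto
  also have "\<dots> \<le> real (card ?cuts) * ?q"
  proof (rule sum_bounded_above)
    fix A assume A: "A \<in> ?cuts"
    show "measure_pmf.prob ?M (?dead A) \<le> ?q"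
      by (rule prob_cut_dies_le[OF feas _ _ d a p]) (use A in auto)
  qed
  also have "\<dots> \<le> 2 ^ n * ?q"
  proof (rule mult_right_mono)
    have "card ?cuts \<le> card (Pow {1..n})" by (rule card_mono) auto
    also have "\<dots> = 2 ^ n" by (simp add: card_Pow)
    finally have "real (card ?cuts) \<le> real (2 ^ n)" by (rule of_nat_mono)
    also have "\<dots> = 2 ^ n" by (simp only: of_nat_power of_nat_numeral)
    finally show "real (card ?cuts) \<le> 2 ^ n" .
  qed simp
  finally show ?thesis by linarith
qed

section \<open>Asymptotics\<close>

lemma eventually_card_S_close:
  fixes \<delta> c :: real
  assumes "(\<lambda>n. real (card (S n (D n) (d n))) - \<delta> * real n) \<in> o(\<lambda>n. real n)" and "c > 0"
  shows "\<forall>\<^sub>F n in sequentially. \<bar>real (card (S n (D n) (d n))) - \<delta> * real n\<bar> \<le> c * real n"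
  using landau_o.smallD[OF assms] by simp

text \<open>Markov's inequality is applied at the threshold \<open>n sqrt (p d)\<close>, which is \<open>o(n)\<close> and yet
  much larger than the mean, at most \<open>n p d\<close>. Adding \<open>1\<close> to it keeps it positive where \<open>p\<close>
  vanishes.\<close>

lemma percolation_L1_upper:
  fixes D :: "nat \<Rightarrow> nat \<Rightarrow> nat" and d p :: "nat \<Rightarrow> real" and \<delta> :: real
  assumes feas: "\<And>n. n \<ge> 2 \<Longrightarrow> feasible n (D n)" and d_pos: "\<And>n. d n > 0"
    and S_size: "(\<lambda>n. real (card (S n (D n) (d n))) - \<delta> * real n) \<in> o(\<lambda>n. real n)"
    and p_range: "\<And>n. p n \<in> {0..1}" and p: "p \<in> o(\<lambda>n. 1 / d n)"
  shows "\<exists>h \<in> o(\<lambda>n. real n).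
          (\<lambda>n. measure_pmf.prob (percolated_random_graph n (D n) (p n))
                 {E. real (L1 n E) \<le> \<delta> * real n + h n}) \<longlonglongrightarrow> 1"
proof -
  define r where "r n = sqrt (p n * d n)" for n
  define err where "err n = \<bar>real (card (S n (D n) (d n))) - \<delta> * real n\<bar>" for n
  define a where "a n = real n * r n + 1" for n
  define h where "h n = err n + (2 + real n * r n)" for n
  have pd0: "p n * d n \<ge> 0" for n using p_range[of n] d_pos[of n] by simp
  have r0: "r n \<ge> 0" for n using pd0 by (simp add: r_def)
  have "(\<lambda>n. p n / (1 / d n)) \<longlonglongrightarrow> 0" using smalloD_tendsto[OF p] .
  then have "(\<lambda>n. p n * d n) \<longlonglongrightarrow> 0" by simp
  then have r_lim: "r \<longlonglongrightarrow> 0" unfolding r_def using tendsto_real_sqrt by fastforce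
  have err_o: "err \<in> o(\<lambda>n. real n)"
    using S_size unfolding err_def by simp
  have nr: "(\<lambda>n. real n * r n) \<in> o(\<lambda>n. real n)"
  proof (rule smalloI_tendsto)
    have "\<forall>\<^sub>F n in sequentially. r n = real n * r n / real n"
      using eventually_gt_at_top[of 0] by eventually_elim simp
    then show "(\<lambda>n. real n * r n / real n) \<longlonglongrightarrow> 0" by (rule Lim_transform_eventually[OF r_lim])
    show "\<forall>\<^sub>F n in sequentially. real n \<noteq> 0" using eventually_gt_at_top[of 0] by eventually_elim simp
  qed
  have two: "(\<lambda>n. 2 :: real) \<in> o(\<lambda>n. real n)"
    by (rule smalloI_tendsto) (real_asymp, rule eventually_mono[OF eventually_gt_at_top[of 0]], simp)
  have h_o: "h \<in> o(\<lambda>n. real n)"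
    unfolding h_def by (intro sum_in_smallo err_o two nr)
  have "(\<lambda>n. measure_pmf.prob (percolated_random_graph n (D n) (p n))
                 {E. real (L1 n E) \<le> \<delta> * real n + h n}) \<longlonglongrightarrow> 1"
  proof (rule tendsto_sandwich)
    show "(\<lambda>n. 1 - r n) \<longlonglongrightarrow> 1" using tendsto_diff[OF tendsto_const r_lim, of 1] by simp
    show "(\<lambda>n. 1) \<longlonglongrightarrow> (1 :: real)" by simp
    show "\<forall>\<^sub>F n in sequentially. measure_pmf.prob (percolated_random_graph n (D n) (p n))
                 {E. real (L1 n E) \<le> \<delta> * real n + h n} \<le> 1"
      by simp
    show "\<forall>\<^sub>F n in sequentially. 1 - r n \<le> measure_pmf.prob (percolated_random_graph n (D n) (p n))
                 {E. real (L1 n E) \<le> \<delta> * real n + h n}"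
      using eventually_ge_at_top[of 2]
    proof eventually_elim
      case (elim n)
      let ?M = "percolated_random_graph n (D n) (p n)"
      let ?big = "{E. real (L1 n E) \<ge> real (card (S n (D n) (d n))) + 1 + a n}"
      have a: "a n > 0" using r0[of n] by (simp add: a_def add_nonneg_pos)
      have rr: "p n * d n = r n * r n" using pd0 by (simp add: r_def)
      have "measure_pmf.prob ?M ?big \<le> real n * (p n * d n) / a n"
        by (rule prob_L1_large_le) (use elim feas d_pos p_range a in auto)
      also have "\<dots> \<le> r n"
        unfolding rr using a r0[of n] by (simp add: a_def field_simps)
      finally have "1 - r n \<le> 1 - measure_pmf.prob ?M ?big" by simp
      also have "\<dots> = measure_pmf.prob ?M (- ?big)"
        using measure_pmf.prob_compl[of ?big ?M] by (simp add: Compl_eq_Diff_UNIV)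
      also have "\<dots> \<le> measure_pmf.prob ?M {E. real (L1 n E) \<le> \<delta> * real n + h n}"
      proof (rule measure_pmf.finite_measure_mono)
        show "- ?big \<subseteq> {E. real (L1 n E) \<le> \<delta> * real n + h n}"
        proof
          fix E assume "E \<in> - ?big"
          then have "real (L1 n E) \<le> real (card (S n (D n) (d n))) + 1 + a n" by simp
          also have "\<dots> \<le> \<delta> * real n + h n" unfolding h_def a_def err_def by linarith
          finally show "E \<in> {E. real (L1 n E) \<le> \<delta> * real n + h n}" by simp
        qed
      qed simp
      finally show ?case .
    qed
  qed
  with h_o show ?thesis by blast
qed

text \<open>The choice \<open>\<epsilon> = 1 / sqrt (p d)\<close> balances two demands: \<open>\<epsilon> \<longrightarrow> 0\<close>, so that only \<open>o(n)\<close>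
  vertices are lost, and \<open>p \<epsilon> d \<longrightarrow> \<infinity>\<close>, so that the union bound over \<open>2\<^sup>n\<close> cuts succeeds.\<close>

lemma percolation_giant:
  fixes D :: "nat \<Rightarrow> nat \<Rightarrow> nat" and d p :: "nat \<Rightarrow> real" and \<delta> :: real
  assumes feas: "\<And>n. n \<ge> 2 \<Longrightarrow> feasible n (D n)" and d_pos: "\<And>n. d n > 0"
    and S_size: "(\<lambda>n. real (card (S n (D n) (d n))) - \<delta> * real n) \<in> o(\<lambda>n. real n)"
    and p_range: "\<And>n. p n \<in> {0..1}" and p: "(\<lambda>n. 1 / d n) \<in> o(p)" and \<delta>: "\<delta> > 0"
  obtains \<epsilon> :: "nat \<Rightarrow> real" where "\<epsilon> \<longlonglongrightarrow> 0"
    and "(\<lambda>n. measure_pmf.prob (percolated_random_graph n (D n) (p n))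
            {E. \<exists>C\<in>graph_components n E.
                  real (card (C \<inter> S n (D n) (d n)))
                    \<ge> real (card (S n (D n) (d n))) - 2 * (\<epsilon> n * real n)}) \<longlonglongrightarrow> 1"
proof
  define r where "r n = sqrt (p n * d n)" for n
  define \<epsilon> where "\<epsilon> n = 1 / r n" for n
  have "filterlim (\<lambda>n. p n * d n) at_top sequentially"
    unfolding filterlim_at_top_gt[where c = 0]
  proof (intro allI impI)
    fix Z :: real assume Z: "Z > 0"
    have "\<forall>\<^sub>F n in sequentially. norm (1 / d n) \<le> 1 / Z * norm (p n)"
      using landau_o.smallD[OF p, of "1 / Z"] Z by simp
    then show "\<forall>\<^sub>F n in sequentially. Z \<le> p n * d n"
    proof eventually_elim
      case (elim n)
      then show ?case using d_pos[of n] p_range[of n] Z by (simp add: field_simps)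
    qed
  qed
  then have r_lim: "filterlim r at_top sequentially"
    unfolding r_def by (rule filterlim_compose[OF sqrt_at_top])
  show \<epsilon>_lim: "\<epsilon> \<longlonglongrightarrow> 0"
    unfolding \<epsilon>_def by (rule real_tendsto_divide_at_top[OF tendsto_const r_lim])
  show "(\<lambda>n. measure_pmf.prob (percolated_random_graph n (D n) (p n))
            {E. \<exists>C\<in>graph_components n E.
                  real (card (C \<inter> S n (D n) (d n)))
                    \<ge> real (card (S n (D n) (d n))) - 2 * (\<epsilon> n * real n)}) \<longlonglongrightarrow> 1"
    (is "(\<lambda>n. ?P n) \<longlonglongrightarrow> 1")
  proof (rule tendsto_sandwich)
    show "(\<lambda>n. 1 - 4 * exp (- real n)) \<longlonglongrightarrow> 1" by real_asymp
    show "(\<lambda>n. 1) \<longlonglongrightarrow> (1 :: real)" by simp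
    show "\<forall>\<^sub>F n in sequentially. ?P n \<le> 1" by simp
    have "\<forall>\<^sub>F n in sequentially. \<epsilon> n < \<delta> / 2"
      using \<epsilon>_lim \<delta> by (intro order_tendstoD(2)) auto
    moreover have "\<forall>\<^sub>F n in sequentially. 64 \<le> r n"
      using r_lim by (simp add: filterlim_at_top)
    moreover have "\<forall>\<^sub>F n in sequentially. \<bar>real (card (S n (D n) (d n))) - \<delta> * real n\<bar> \<le> \<delta> / 2 * real n"
      using \<delta> by (intro eventually_card_S_close[OF S_size]) simp
    \<comment> \<open>From \<open>64 \<le> r n\<close> on, the exponent \<open>n * r n / 32\<close> is at least \<open>2 n\<close>: one \<open>exp (- n)\<close> pays
      for the \<open>2 ^ n\<close> cuts, and the other one is the bound.\<close>
    ultimately show "\<forall>\<^sub>F n in sequentially. 1 - 4 * exp (- real n) \<le> ?P n"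
      using eventually_ge_at_top[of 2]
    proof eventually_elim
      case (elim n)
      have r: "r n > 0" using elim by simp
      have "\<epsilon> n * real n \<le> \<delta> / 2 * real n" using elim by (intro mult_right_mono) auto
      then have Sa: "\<epsilon> n * real n \<le> real (card (S n (D n) (d n)))" using elim by linarith
      have a: "\<epsilon> n * real n > 0" using r elim by (simp add: \<epsilon>_def)
      have "p n * d n = r n * r n" using p_range[of n] d_pos[of n] by (simp add: r_def)
      then have "p n * (\<epsilon> n * real n * d n) = real n * r n"
        using r by (simp add: \<epsilon>_def field_simps)
      then have "2 * real n \<le> p n * (\<epsilon> n * real n * d n) / 32"
        using mult_left_mono[of 64 "r n" "real n"] elim by simp
      then have "exp (- (p n * (\<epsilon> n * real n * d n) / 32)) \<le> exp (- (2 * real n))" by simp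
      also have "\<dots> = exp (- real n) * exp (- real n)" by (simp add: exp_add[symmetric])
      finally have "2 ^ n * exp (- (p n * (\<epsilon> n * real n * d n) / 32))
          \<le> 2 ^ n * (exp (- real n) * exp (- real n))"
        by (rule mult_left_mono) simp
      also have "(2 :: real) ^ n \<le> exp 1 ^ n"
        using exp_ge_add_one_self[of 1] by (intro power_mono) auto
      also have "exp 1 ^ n * (exp (- real n) * exp (- real n)) = exp (- real n)"
        by (simp add: exp_of_nat_mult[symmetric] exp_add[symmetric])
      finally have "1 - 4 * exp (- real n)
          \<le> 1 - 2 ^ n * (4 * exp (- (p n * (\<epsilon> n * real n * d n) / 32)))"
        by simp
      also have "\<dots> \<le> ?P n"
        by (rule prob_giant_ge) (use elim feas d_pos p_range a Sa in auto)
      finally show ?case .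
    qed
  qed
qed

theorem theorem1p1:
  fixes D :: "nat \<Rightarrow> nat \<Rightarrow> nat" and d p :: "nat \<Rightarrow> real" and \<delta> :: real
  assumes feas: "\<And>n. n \<ge> 2 \<Longrightarrow> feasible n (D n)"
    and d_pos: "\<And>n. d n > 0"
    and \<delta>_nonneg: "\<delta> \<ge> 0"
    and S_size: "(\<lambda>n. real (card (S n (D n) (d n))) - \<delta> * real n) \<in> o(\<lambda>n. real n)"
    and p_range: "\<And>n. p n \<in> {0..1}"
  shows
    "(p \<in> o(\<lambda>n. 1 / d n) \<longrightarrow>
        (\<exists>h \<in> o(\<lambda>n. real n).
          (\<lambda>n. measure_pmf.prob (percolated_random_graph n (D n) (p n))
                 {E. real (L1 n E) \<le> \<delta> * real n + h n}) \<longlonglongrightarrow> 1))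
   \<and> ((\<lambda>n. 1 / d n) \<in> o(p) \<longrightarrow>
        (\<exists>h \<in> o(\<lambda>n. real n).
          (\<lambda>n. measure_pmf.prob (percolated_random_graph n (D n) (p n))
                 {E. real (L1 n E) \<ge> \<delta> * real n - h n}) \<longlonglongrightarrow> 1)
      \<and> (\<delta> > 0 \<longrightarrow>
          (\<exists>\<eta> \<in> o(\<lambda>n. 1 :: real).
            (\<lambda>n. measure_pmf.prob (percolated_random_graph n (D n) (p n))
                   {E. \<exists>C \<in> graph_components n E.
                         real (card (C \<inter> S n (D n) (d n)))
                           \<ge> (1 - \<eta> n) * real (card (S n (D n) (d n)))}) \<longlonglongrightarrow> 1)))"
proof (intro conjI impI)
  assume p: "p \<in> o(\<lambda>n. 1 / d n)"
  show "\<exists>h \<in> o(\<lambda>n. real n).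
          (\<lambda>n. measure_pmf.prob (percolated_random_graph n (D n) (p n))
                 {E. real (L1 n E) \<le> \<delta> * real n + h n}) \<longlonglongrightarrow> 1"
    by (rule percolation_L1_upper[OF _ d_pos S_size p_range p]) (rule feas)
next
  assume p: "(\<lambda>n. 1 / d n) \<in> o(p)"
  show "\<exists>h \<in> o(\<lambda>n. real n).
          (\<lambda>n. measure_pmf.prob (percolated_random_graph n (D n) (p n))
                 {E. real (L1 n E) \<ge> \<delta> * real n - h n}) \<longlonglongrightarrow> 1"
  proof (cases "\<delta> = 0")
    case True
    then show ?thesis by (intro bexI[of _ "\<lambda>_. 0"]) auto
  next
    case False
    then have \<delta>: "\<delta> > 0" using \<delta>_nonneg by simp
    obtain \<epsilon> where \<epsilon>: "\<epsilon> \<longlonglongrightarrow> 0"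
      and giant: "(\<lambda>n. measure_pmf.prob (percolated_random_graph n (D n) (p n))
            {E. \<exists>C\<in>graph_components n E.
                  real (card (C \<inter> S n (D n) (d n)))
                    \<ge> real (card (S n (D n) (d n))) - 2 * (\<epsilon> n * real n)}) \<longlonglongrightarrow> 1"
        (is "?P \<longlonglongrightarrow> 1")
      using percolation_giant[OF feas d_pos S_size p_range p \<delta>] by blast
    define err where "err n = \<bar>real (card (S n (D n) (d n))) - \<delta> * real n\<bar>" for n
    define h where "h n = err n + 2 * (\<epsilon> n * real n)" for n
    have err_o: "err \<in> o(\<lambda>n. real n)" using S_size unfolding err_def by simp
    have "(\<lambda>n. \<epsilon> n * real n) \<in> o(\<lambda>n. 1 * real n)"
      using \<epsilon> by (intro landau_o.small_big_mult smalloI_tendsto) auto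
    then have h_o: "h \<in> o(\<lambda>n. real n)" unfolding h_def by (intro sum_in_smallo err_o) simp
    have "(\<lambda>n. measure_pmf.prob (percolated_random_graph n (D n) (p n))
                 {E. real (L1 n E) \<ge> \<delta> * real n - h n}) \<longlonglongrightarrow> 1"
    proof (rule tendsto_sandwich[OF _ _ giant tendsto_const])
      show "\<forall>\<^sub>F n in sequentially. ?P n \<le> measure_pmf.prob (percolated_random_graph n (D n) (p n))
                 {E. real (L1 n E) \<ge> \<delta> * real n - h n}"
      proof (intro always_eventually allI measure_pmf.finite_measure_mono subsetI)
        fix n E
        assume "E \<in> {E. \<exists>C\<in>graph_components n E.
                  real (card (C \<inter> S n (D n) (d n)))
                    \<ge> real (card (S n (D n) (d n))) - 2 * (\<epsilon> n * real n)}"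
        then obtain C where C: "C \<in> graph_components n E"
          and CS: "real (card (C \<inter> S n (D n) (d n)))
                    \<ge> real (card (S n (D n) (d n))) - 2 * (\<epsilon> n * real n)" by blast
        have "finite C" using component_subset[OF C] finite_subset by blast
        then have "card (C \<inter> S n (D n) (d n)) \<le> card C" by (intro card_mono) auto
        also have "\<dots> \<le> L1 n E" by (rule card_component_le_L1[OF C])
        finally have "\<delta> * real n - h n \<le> real (L1 n E)"
          using CS unfolding h_def err_def by linarith
        then show "E \<in> {E. real (L1 n E) \<ge> \<delta> * real n - h n}" by simp
      qed simp
    qed simp
    with h_o show ?thesis by blast
  qed
next
  assume p: "(\<lambda>n. 1 / d n) \<in> o(p)" and \<delta>: "\<delta> > 0"
  obtain \<epsilon> where \<epsilon>: "\<epsilon> \<longlonglongrightarrow> 0"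
    and giant: "(\<lambda>n. measure_pmf.prob (percolated_random_graph n (D n) (p n))
            {E. \<exists>C\<in>graph_components n E.
                  real (card (C \<inter> S n (D n) (d n)))
                    \<ge> real (card (S n (D n) (d n))) - 2 * (\<epsilon> n * real n)}) \<longlonglongrightarrow> 1"
      (is "?P \<longlonglongrightarrow> 1")
    using percolation_giant[OF feas d_pos S_size p_range p \<delta>] by blast
  \<comment> \<open>Eventually \<open>card S \<ge> \<delta> n / 2\<close>, so \<open>2 \<epsilon> n\<close> lost vertices are a proportion of at most
    \<open>4 \<epsilon> / \<delta>\<close> of \<open>S\<close>.\<close>
  define \<eta> where "\<eta> n = 4 / \<delta> * \<bar>\<epsilon> n\<bar>" for n
  have "\<eta> \<longlonglongrightarrow> 0"
    unfolding \<eta>_def by (rule tendsto_mult_right_zero[OF tendsto_rabs_zero[OF \<epsilon>]])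
  then have \<eta>_o: "\<eta> \<in> o(\<lambda>n. 1 :: real)" by (intro smalloI_tendsto) auto
  have "(\<lambda>n. measure_pmf.prob (percolated_random_graph n (D n) (p n))
                   {E. \<exists>C \<in> graph_components n E.
                         real (card (C \<inter> S n (D n) (d n)))
                           \<ge> (1 - \<eta> n) * real (card (S n (D n) (d n)))}) \<longlonglongrightarrow> 1"
    (is "?Q \<longlonglongrightarrow> 1")
  proof (rule tendsto_sandwich[OF _ _ giant tendsto_const])
    have "\<forall>\<^sub>F n in sequentially. \<bar>real (card (S n (D n) (d n))) - \<delta> * real n\<bar> \<le> \<delta> / 2 * real n"
      using \<delta> by (intro eventually_card_S_close[OF S_size]) simp
    then show "\<forall>\<^sub>F n in sequentially. ?P n \<le> ?Q n"
    proof eventually_elim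
      case (elim n)
      let ?s = "real (card (S n (D n) (d n)))"
      have "2 * (\<epsilon> n * real n) \<le> \<eta> n * (\<delta> / 2 * real n)"
        using \<delta> mult_left_mono[of "\<epsilon> n" "\<bar>\<epsilon> n\<bar>" "real n"] by (simp add: \<eta>_def mult.commute)
      also have "\<dots> \<le> \<eta> n * ?s"
      proof (rule mult_left_mono)
        show "\<delta> / 2 * real n \<le> ?s" using elim by linarith
      qed (use \<delta> in \<open>simp add: \<eta>_def\<close>)
      finally have "(1 - \<eta> n) * ?s \<le> ?s - 2 * (\<epsilon> n * real n)" by (simp add: algebra_simps)
      then show ?case
        by (intro measure_pmf.finite_measure_mono subsetI) (auto intro: order_trans)
    qed
  qed simp
  with \<eta>_o show "\<exists>\<eta> \<in> o(\<lambda>n. 1 :: real).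
            (\<lambda>n. measure_pmf.prob (percolated_random_graph n (D n) (p n))
                   {E. \<exists>C \<in> graph_components n E.
                         real (card (C \<inter> S n (D n) (d n)))
                           \<ge> (1 - \<eta> n) * real (card (S n (D n) (d n)))}) \<longlonglongrightarrow> 1"
    by blast
qed

end
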